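(* (Binomial Theorem for the join.) Let $n$ be a positive integer and let $x,y\in\mathbb{R}_\infty=\mathbb{R}\cup\{-\infty,+\infty\}$ be such that all sums $(n-k)x+ky$, $0\le k\le n$, are defined (for instance, any $x,y\in\mathbb{R}$). Then $$n(x\vee y)=\bigvee_{k=0}^{n}\binom{n}{k}_{\!\vee}\,[(n-k)x+ky].$$
   Context: $\mathbb{R}_\infty=\mathbb{R}\cup\{-\infty,+\infty\}$ is the extended real number system (with $\infty-\infty$ undefined) and the conventions $\ln(0)=-\infty$, $\ln(+\infty)=+\infty$, $e^{-\infty}=0$, $e^{+\infty}=+\infty$. The join operation is $x\vee y:=\ln(e^x+e^y)$; it is associative and commutative. For a positive integer $m$, $m_\vee x:=x\vee\cdots\vee x$ ($m$ copies of $x$), with $1_\vee x=x$; so $\binom{n}{k}_{\!\vee}w$ denotes the join of $\binom{n}{k}$ copies of $w$. For a nonnegative integer $m$, $mx$ is the ordinary $m$-fold sum $x+\cdots+x$, with $0x=0$. Finally $\bigvee_{k=0}^n x_k:=x_0\vee x_1\vee\cdots\vee x_n$. *)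

theory Defs
  imports Complex_Main "HOL-Library.Extended_Real"
begin

function exp_ereal :: "ereal \<Rightarrow> ereal" where
  "exp_ereal (ereal r) = ereal (exp r)"
| "exp_ereal \<infinity> = \<infinity>"
| "exp_ereal (-\<infinity>) = 0"
  by (auto intro: ereal_cases)
termination by standard (rule wf_on_bot)

(* Only the values on [0, \<infinity>] are meaningful; those on negative arguments are arbitrary. *)
function ln_ereal :: "ereal \<Rightarrow> ereal" where
  "ln_ereal (ereal r) = (if r = 0 then -\<infinity> else ereal (ln r))"
| "ln_ereal \<infinity> = \<infinity>"
| "ln_ereal (-\<infinity>) = -\<infinity>"
  by (auto intro: ereal_cases)
termination by standard (rule wf_on_bot)

(* Addition on ereal is total, with the convention \<infinity> + (-\<infinity>) = \<infinity>.  The predicate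
   singles out the sums that are defined in the extended reals. *)
definition sum_defined :: "ereal \<Rightarrow> ereal \<Rightarrow> bool" where
  "sum_defined a b \<longleftrightarrow> \<not> (a = \<infinity> \<and> b = -\<infinity>) \<and> \<not> (a = -\<infinity> \<and> b = \<infinity>)"

(* Both exponentials are nonnegative, so the sum inside the logarithm is always defined. *)
definition join :: "ereal \<Rightarrow> ereal \<Rightarrow> ereal"  (infixl \<open>\<squnion>\<^sub>e\<close> 65) where
  "x \<squnion>\<^sub>e y = ln_ereal (exp_ereal x + exp_ereal y)"

(* f 0 joined with f 1, ..., f n, both ends included *)
primrec big_join :: "nat \<Rightarrow> (nat \<Rightarrow> ereal) \<Rightarrow> ereal" where
  "big_join 0 f = f 0"
| "big_join (Suc n) f = big_join n f \<squnion>\<^sub>e f (Suc n)"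

(* The join of m copies of x, for positive m.  The value at m = 0 is a convention:
   -\<infinity> is the neutral element of the join. *)
fun join_mult :: "nat \<Rightarrow> ereal \<Rightarrow> ereal" where
  "join_mult 0 x = -\<infinity>"
| "join_mult (Suc 0) x = x"
| "join_mult (Suc (Suc m)) x = join_mult (Suc m) x \<squnion>\<^sub>e x"

definition sum_mult :: "nat \<Rightarrow> ereal \<Rightarrow> ereal" where
  "sum_mult m x = (\<Sum>i<m. x)"

end

(*
  The map e^x from the extended reals to the extended nonnegative reals is a bijection that turns
  joins into sums and defined sums into products.  Extended nonnegative reals form a commutative
  semiring, so the classical binomial theorem holds there and pulls back along this map.
*)
theory Submission
  imports Defs "HOL-Library.Extended_Nonnegative_Real"
begin

text \<open>The values of \<open>exp_ereal\<close> are nonnegative, so \<open>e2ennreal\<close>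
  truncates nothing, and in \<open>ennreal\<close> the distributive law holds without side
  conditions.\<close>

definition exp_ennreal :: "ereal \<Rightarrow> ennreal" where
  "exp_ennreal x = e2ennreal (exp_ereal x)"

lemma exp_ereal_nonneg: "0 \<le> exp_ereal x"
  by (cases x) auto

lemma inj_exp_ereal: "inj exp_ereal"
proof (rule injI)
  fix x y assume "exp_ereal x = exp_ereal y"
  then show "x = y"
    by (cases x; cases y) (auto simp: zero_ereal_def)
qed

lemma inj_exp_ennreal: "inj exp_ennreal"
proof (rule injI)
  fix x y assume "exp_ennreal x = exp_ennreal y"
  then have "exp_ereal x = exp_ereal y"
    unfolding exp_ennreal_def by (metis enn2ereal_e2ennreal exp_ereal_nonneg)
  then show "x = y"
    by (rule injD[OF inj_exp_ereal])
qed

lemma exp_ln_ereal: "0 \<le> a \<Longrightarrow> exp_ereal (ln_ereal a) = a"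
  by (cases a) (auto simp: zero_ereal_def)

lemma exp_ennreal_join: "exp_ennreal (x \<squnion>\<^sub>e y) = exp_ennreal x + exp_ennreal y"
  by (simp add: exp_ennreal_def join_def exp_ln_ereal exp_ereal_nonneg plus_ennreal.abs_eq
      eq_onp_same_args)

text \<open>Opposite infinities must be excluded: by the library conventions their sum is
  \<infinity>, with exponential \<infinity>, while the product is \<infinity> * 0 = 0.\<close>

lemma exp_ereal_add:
  assumes "sum_defined x y"
  shows "exp_ereal (x + y) = exp_ereal x * exp_ereal y"
  using assms by (cases x; cases y) (auto simp: sum_defined_def exp_add zero_ereal_def)

lemma exp_ennreal_add:
  "sum_defined x y \<Longrightarrow> exp_ennreal (x + y) = exp_ennreal x * exp_ennreal y"
  by (simp add: exp_ennreal_def exp_ereal_add exp_ereal_nonneg times_ennreal.abs_eq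
      eq_onp_same_args)

text \<open>A multiple of an infinite x is 0 or x, never the opposite infinity. This lets
  \<open>exp_ennreal_add\<close> drive the induction for powers.\<close>

lemma sum_defined_sum_mult: "sum_defined (sum_mult m x) x"
proof -
  have "0 \<le> sum_mult m \<infinity>"
    by (simp add: sum_mult_def sum_nonneg)
  then show ?thesis
    by (cases x) (auto simp: sum_defined_def sum_mult_def sum_Pinfty)
qed

lemma exp_ennreal_sum_mult: "exp_ennreal (sum_mult m x) = exp_ennreal x ^ m"
proof (induction m)
  case 0
  then show ?case
    by (simp add: exp_ennreal_def sum_mult_def zero_ereal_def flip: one_ereal_def one_ennreal.abs_eq)
next
  case (Suc m)
  have "sum_mult (Suc m) x = sum_mult m x + x"
    by (simp add: sum_mult_def add.commute)
  then show ?case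
    using Suc by (simp add: exp_ennreal_add sum_defined_sum_mult mult.commute)
qed

text \<open>At m = 0 the empty join -\<infinity> has exponential 0, which agrees with 0 *
  \<infinity> = 0 when x = \<infinity>.\<close>

lemma exp_ennreal_join_mult: "exp_ennreal (join_mult m x) = of_nat m * exp_ennreal x"
proof (induction m x rule: join_mult.induct)
  case (1 x)
  then show ?case by (simp add: exp_ennreal_def flip: zero_ennreal.abs_eq)
qed (simp_all add: exp_ennreal_join distrib_right add_ac)

lemma exp_ennreal_big_join: "exp_ennreal (big_join n f) = (\<Sum>k\<le>n. exp_ennreal (f k))"
  by (induction n) (simp_all add: exp_ennreal_join)

theorem theorem3p2:
  fixes n :: nat and x y :: ereal
  assumes "n \<ge> 1"
    and "\<And>k. k \<le> n \<Longrightarrow> sum_defined (sum_mult (n - k) x) (sum_mult k y)"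
  shows "sum_mult n (x \<squnion>\<^sub>e y) =
         big_join n (\<lambda>k. join_mult (n choose k) (sum_mult (n - k) x + sum_mult k y))"
proof (rule injD[OF inj_exp_ennreal])
  \<comment> \<open>The summands are swapped because \<open>binomial_ring\<close> gives the exponent
    k to the first one, and here k counts copies of y.\<close>
  have "exp_ennreal (sum_mult n (x \<squnion>\<^sub>e y)) = (exp_ennreal y + exp_ennreal x) ^ n"
    by (simp add: exp_ennreal_sum_mult exp_ennreal_join add.commute)
  also have "\<dots> = (\<Sum>k\<le>n. of_nat (n choose k) * exp_ennreal y ^ k * exp_ennreal x ^ (n - k))"
    by (rule binomial_ring)
  \<comment> \<open>Definedness of the k-th sum turns the product of the two powers back into one
    exponential.\<close>
  also have "\<dots> = (\<Sum>k\<le>n. exp_ennreal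
      (join_mult (n choose k) (sum_mult (n - k) x + sum_mult k y)))"
    by (intro sum.cong refl)
      (simp add: exp_ennreal_join_mult exp_ennreal_add assms(2) exp_ennreal_sum_mult mult_ac)
  finally show "exp_ennreal (sum_mult n (x \<squnion>\<^sub>e y)) = exp_ennreal
      (big_join n (\<lambda>k. join_mult (n choose k) (sum_mult (n - k) x + sum_mult k y)))"
    by (simp add: exp_ennreal_big_join)
qed

end
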